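(* For all $k\in\mathbb{N}$ (positive integers), there exists a graph $G$ such that $\delta(G)=k$ and $\operatorname{dom}_g(G,X)=1$ for each $X\in\{A,B\}$.
   Context: All graphs are finite and simple; $\delta(G)$ is the minimum degree. A set $S\subseteq V(G)$ is dominating if every vertex of $G$ is in $S$ or adjacent to a vertex of $S$. The domatic game on $G$ with palette size $k$: players Alice and Bob alternately choose an uncolored vertex of $G$ and color it with a color from $[k]=\{1,\dots,k\}$, until every vertex is colored. Alice wins if for every $c\in[k]$ the set of vertices colored $c$ is a dominating set of $G$; otherwise Bob wins. For $X\in\{A,B\}$, $X$ indicates who moves first ($A$ = Alice, $B$ = Bob). The domatic game number $\operatorname{dom}_g(G,X)$ is the largest $k$ such that Alice has a winning strategy in the domatic game on $G$ with palette size $k$ when $X$ moves first. *)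

theory Defs
  imports "Graph_Theory.Graph_Theory"
begin

text \<open>
  A finite simple graph is a \<^locale>\<open>pair_graph\<close>: a finite vertex set together with a finite,
  symmetric, irreflexive set of ordered pairs. As every edge is present in both directions, the
  degree of a vertex is its out-degree.
\<close>

text \<open>Only meaningful if \<^term>\<open>G\<close> has at least one vertex.\<close>
definition min_degree :: "'a pair_pre_digraph \<Rightarrow> nat" where
  "min_degree G = Min (out_degree (with_proj G) ` pverts G)"

definition dominating_set :: "'a pair_pre_digraph \<Rightarrow> 'a set \<Rightarrow> bool" where
  "dominating_set G S \<longleftrightarrow>
     S \<subseteq> pverts G \<and> (\<forall>v\<in>pverts G. v \<in> S \<or> (\<exists>u\<in>S. (u, v) \<in> parcs G))"

datatype player = Alice | Bob

primrec opponent :: "player \<Rightarrow> player" where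
  "opponent Alice = Bob"
| "opponent Bob = Alice"

text \<open>
  A move \<^term>\<open>(v, c)\<close> colors vertex \<^term>\<open>v\<close> with color \<^term>\<open>c\<close>. A position of the game is the
  chronological list of the moves made so far.
\<close>
type_synonym 'a move = "'a \<times> nat"

definition legal_move :: "'a pair_pre_digraph \<Rightarrow> nat \<Rightarrow> 'a move list \<Rightarrow> 'a move \<Rightarrow> bool" where
  "legal_move G k h m \<longleftrightarrow> fst m \<in> pverts G \<and> fst m \<notin> fst ` set h \<and> snd m \<in> {1..k}"

definition play :: "'a pair_pre_digraph \<Rightarrow> nat \<Rightarrow> 'a move list \<Rightarrow> bool" where
  "play G k h \<longleftrightarrow> (\<forall>i<length h. legal_move G k (take i h) (h ! i))"

definition complete_play :: "'a pair_pre_digraph \<Rightarrow> nat \<Rightarrow> 'a move list \<Rightarrow> bool" where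
  "complete_play G k h \<longleftrightarrow> play G k h \<and> fst ` set h = pverts G"

definition color_class :: "'a move list \<Rightarrow> nat \<Rightarrow> 'a set" where
  "color_class h c = {v. (v, c) \<in> set h}"

definition alice_wins :: "'a pair_pre_digraph \<Rightarrow> nat \<Rightarrow> 'a move list \<Rightarrow> bool" where
  "alice_wins G k h \<longleftrightarrow> (\<forall>c\<in>{1..k}. dominating_set G (color_class h c))"

text \<open>The player to move after the moves \<^term>\<open>h\<close>, when \<^term>\<open>X\<close> moves first.\<close>
definition to_move :: "player \<Rightarrow> 'a move list \<Rightarrow> player" where
  "to_move X h = (if even (length h) then X else opponent X)"

type_synonym 'a strategy = "'a move list \<Rightarrow> 'a move"

definition alice_strategy ::
    "'a pair_pre_digraph \<Rightarrow> player \<Rightarrow> nat \<Rightarrow> 'a strategy \<Rightarrow> bool" where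
  "alice_strategy G X k \<sigma> \<longleftrightarrow>
     (\<forall>h. play G k h \<and> \<not> complete_play G k h \<and> to_move X h = Alice \<longrightarrow> legal_move G k h (\<sigma> h))"

definition alice_follows :: "player \<Rightarrow> 'a strategy \<Rightarrow> 'a move list \<Rightarrow> bool" where
  "alice_follows X \<sigma> h \<longleftrightarrow>
     (\<forall>i<length h. to_move X (take i h) = Alice \<longrightarrow> h ! i = \<sigma> (take i h))"

definition alice_has_winning_strategy :: "'a pair_pre_digraph \<Rightarrow> player \<Rightarrow> nat \<Rightarrow> bool" where
  "alice_has_winning_strategy G X k \<longleftrightarrow>
     (\<exists>\<sigma>. alice_strategy G X k \<sigma> \<and>
        (\<forall>h. complete_play G k h \<and> alice_follows X \<sigma> h \<longrightarrow> alice_wins G k h))"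

text \<open>
  The palette is nonempty. For a finite graph with at least one vertex the greatest value exists:
  palette size 1 is winning for Alice, and a winning palette size is at most the number of vertices
  since every color class must be nonempty.
\<close>
definition domatic_game_number :: "'a pair_pre_digraph \<Rightarrow> player \<Rightarrow> nat" where
  "domatic_game_number G X = (GREATEST k. 1 \<le> k \<and> alice_has_winning_strategy G X k)"

end

theory Submission
  imports Defs "HOL-Library.Nat_Bijection"
begin

text \<open>
  Bob wins with every palette of size at least 2 once he owns a closed neighbourhood, since he
  colors all of it with color 1. In the witness every \<^term>\<open>k\<close>-subset of a core of \<^term>\<open>2 * k\<close>
  vertices is the neighbourhood of \<^term>\<open>2 * k + 2\<close> further vertices. Bob first takes \<^term>\<open>k\<close> core
  vertices. By then at most \<^term>\<open>2 * k + 1\<close> vertices are colored, so one of the vertices attached to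
  exactly his \<^term>\<open>k\<close>-set is free, and he takes it as well.
\<close>

section \<open>Plays and the strategies of Alice\<close>

lemma play_Nil [simp]: "play G m []"
  by (simp add: play_def)

lemma play_snoc: "play G m (h @ [x]) \<longleftrightarrow> play G m h \<and> legal_move G m h x"
  by (auto simp: play_def nth_append less_Suc_eq)

lemma alice_follows_Nil [simp]: "alice_follows X \<sigma> []"
  by (simp add: alice_follows_def)

lemma alice_follows_snoc:
  "alice_follows X \<sigma> (h @ [x]) \<longleftrightarrow>
     alice_follows X \<sigma> h \<and> (to_move X h = Alice \<longrightarrow> x = \<sigma> h)"
  by (auto simp: alice_follows_def nth_append less_Suc_eq)

lemma opponent_opponent [simp]: "opponent (opponent X) = X"
  by (cases X) auto

lemma to_move_snoc [simp]: "to_move X (h @ [x]) = opponent (to_move X h)"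
  by (simp add: to_move_def)

lemma play_vertices_subset: "play G m h \<Longrightarrow> fst ` set h \<subseteq> pverts G"
  by (induction h rule: rev_induct) (auto simp: play_snoc legal_move_def)

lemma card_played:
  assumes "play G m h"
  shows "card (fst ` set h) = length h"
  using assms by (induction h rule: rev_induct) (auto simp: play_snoc legal_move_def)

lemma play_colors: "play G m h \<Longrightarrow> (v, c) \<in> set h \<Longrightarrow> c \<in> {1..m}"
  by (induction h rule: rev_induct) (auto simp: play_snoc legal_move_def)

lemma play_color_unique:
  assumes "play G m h" "(v, c) \<in> set h" "(v, d) \<in> set h"
  shows "c = d"
  using assms
  by (induction h rule: rev_induct) (auto simp: play_snoc legal_move_def image_iff)

lemma incomplete_play_legal_move:
  assumes "play G m h" "\<not> complete_play G m h" "1 \<le> m"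
  shows "\<exists>x. legal_move G m h x"
proof -
  obtain v where "v \<in> pverts G" "v \<notin> fst ` set h"
    using assms play_vertices_subset[OF assms(1)] by (auto simp: complete_play_def)
  then have "legal_move G m h (v, 1)"
    using assms(3) by (auto simp: legal_move_def)
  then show ?thesis ..
qed

lemma alice_strategy_legal_move:
  assumes "alice_strategy G X m \<sigma>" "play G m h" "\<not> complete_play G m h" "to_move X h = Alice"
  shows "legal_move G m h (\<sigma> h)"
  using assms by (auto simp: alice_strategy_def)

lemma alice_strategy_exists:
  assumes "1 \<le> m"
  shows "\<exists>\<sigma>. alice_strategy G X m \<sigma>"
proof
  show "alice_strategy G X m (\<lambda>h. SOME x. legal_move G m h x)"
    unfolding alice_strategy_def
    using incomplete_play_legal_move[OF _ _ assms] by (blast intro: someI_ex)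
qed

text \<open>Winning is defined through complete plays only, so a position that is already lost for
  Alice refutes her strategy once it is played to the end. Each move lowers the number of uncolored
  vertices, the measure of the induction.\<close>

lemma complete_play_extension:
  assumes "finite (pverts G)" "1 \<le> m" and \<sigma>: "alice_strategy G X m \<sigma>"
    and "play G m h" "alice_follows X \<sigma> h"
  shows "\<exists>t. complete_play G m (h @ t) \<and> alice_follows X \<sigma> (h @ t)"
  using assms(4,5)
proof (induction "card (pverts G) - length h" arbitrary: h rule: less_induct)
  case less
  show ?case
  proof (cases "complete_play G m h")
    case True
    then show ?thesis using less.prems by (intro exI[of _ "[]"]) auto
  next
    case False
    \<comment> \<open>On Alice's turn \<open>x\<close> is the move of \<open>\<sigma>\<close>; on
      Bob's turn any legal move serves.\<close>
    obtain x where x: "legal_move G m h x" "to_move X h = Alice \<longrightarrow> x = \<sigma> h"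
      using incomplete_play_legal_move[OF less.prems(1) False assms(2)]
        alice_strategy_legal_move[OF \<sigma> less.prems(1) False] by metis
    have p: "play G m (h @ [x])" "alice_follows X \<sigma> (h @ [x])"
      using x less.prems by (auto simp: play_snoc alice_follows_snoc)
    have "length (h @ [x]) \<le> card (pverts G)"
      using card_mono[OF assms(1) play_vertices_subset[OF p(1)]] card_played[OF p(1)] by simp
    then have "\<exists>t. complete_play G m ((h @ [x]) @ t) \<and> alice_follows X \<sigma> ((h @ [x]) @ t)"
      by (intro less.hyps p) auto
    then show ?thesis by auto
  qed
qed

text \<open>With a single color the only color class of a complete play is the whole vertex set, so
  every legal strategy wins.\<close>

lemma alice_wins_palette_1: "alice_has_winning_strategy G X 1"
proof -
  obtain \<sigma> where \<sigma>: "alice_strategy G X 1 \<sigma>"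
    using alice_strategy_exists[of 1] by blast
  have "alice_wins G 1 h" if "complete_play G 1 h" for h
  proof -
    have p: "play G 1 h" "fst ` set h = pverts G"
      using that by (simp_all add: complete_play_def)
    have "c = 1" if "(v, c) \<in> set h" for v c
      using play_colors[OF p(1) that] by simp
    then have "v \<in> color_class h 1 \<longleftrightarrow> v \<in> fst ` set h" for v
      unfolding color_class_def image_iff Bex_def by (metis mem_Collect_eq fst_conv surj_pair)
    with p(2) have "color_class h 1 = pverts G" by blast
    then show ?thesis by (simp add: alice_wins_def dominating_set_def)
  qed
  with \<sigma> show ?thesis by (auto simp: alice_has_winning_strategy_def)
qed

section \<open>Bob's strategy\<close>

text \<open>Induction on rounds: Bob gives color 1 to a free vertex of \<open>W\<close>, then Alice
  replies. This makes two moves per round; the extra 1 in the length bound is Alice's opening move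
  if she starts.\<close>

lemma bob_takes_core_vertices:
  assumes "finite W" "W \<subseteq> pverts G" "2 * k \<le> card W" "2 * k + 1 < card (pverts G)"
    and "1 \<le> m" and \<sigma>: "alice_strategy G X m \<sigma>" and "j \<le> k"
  shows "\<exists>h S. play G m h \<and> alice_follows X \<sigma> h \<and> to_move X h = Bob \<and> length h \<le> 2 * j + 1 \<and>
           S \<subseteq> W \<and> card S = j \<and> (\<forall>s\<in>S. (s, 1) \<in> set h)"
  using \<open>j \<le> k\<close>
proof (induction j)
  \<comment> \<open>After at most \<open>2 * k + 1\<close> moves a vertex is still free, so
    \<open>\<sigma>\<close> is bound to answer legally.\<close>
  have alice_turn: "legal_move G m h (\<sigma> h)"
    if "play G m h" "to_move X h = Alice" "length h \<le> 2 * k + 1" for h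
  proof (rule alice_strategy_legal_move[OF \<sigma> that(1) _ that(2)])
    show "\<not> complete_play G m h"
      using card_played[OF that(1)] that(3) assms(4) by (auto simp: complete_play_def)
  qed
  {
    case 0
    have "\<exists>h. play G m h \<and> alice_follows X \<sigma> h \<and> to_move X h = Bob \<and> length h \<le> 1"
    proof (cases X)
      case Alice
      then have "legal_move G m [] (\<sigma> [])"
        using alice_turn[of "[]"] by (simp add: to_move_def)
      then show ?thesis
        using Alice play_snoc[of G m "[]"] alice_follows_snoc[of X \<sigma> "[]"]
        by (intro exI[of _ "[\<sigma> []]"]) (auto simp: to_move_def)
    next
      case Bob
      then show ?thesis by (intro exI[of _ "[]"]) (auto simp: to_move_def)
    qed
    then show ?case by fastforce
  next
    case (Suc j)
    then obtain h S where h: "play G m h" "alice_follows X \<sigma> h" "to_move X h = Bob"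
      "length h \<le> 2 * j + 1" and S: "S \<subseteq> W" "card S = j" "\<forall>s\<in>S. (s, 1) \<in> set h"
      by auto
    \<comment> \<open>Since \<open>Suc j \<le> k\<close>, at most \<open>2 * j + 1 < 2 * k\<close>
      vertices are colored.\<close>
    have "\<not> W \<subseteq> fst ` set h"
      using card_mono[of "fst ` set h" W] card_played[OF h(1)] h(4) assms(3) Suc.prems by auto
    then obtain w where w: "w \<in> W" "w \<notin> fst ` set h" by blast
    define h' where "h' = h @ [(w, 1)]"
    have h': "play G m h'" "alice_follows X \<sigma> h'" "to_move X h' = Alice" "length h' \<le> 2 * j + 2"
      using h w assms(2,5)
      by (auto simp: h'_def play_snoc alice_follows_snoc legal_move_def)
    then have "legal_move G m h' (\<sigma> h')"
      using alice_turn Suc.prems by auto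
    then have "play G m (h' @ [\<sigma> h'])" "alice_follows X \<sigma> (h' @ [\<sigma> h'])"
      "to_move X (h' @ [\<sigma> h']) = Bob" "length (h' @ [\<sigma> h']) \<le> 2 * Suc j + 1"
      using h' by (auto simp: play_snoc alice_follows_snoc)
    moreover have "w \<notin> S" using S(3) w(2) by force
    then have "card (insert w S) = Suc j"
      using S finite_subset[OF S(1) assms(1)] by simp
    moreover have "insert w S \<subseteq> W" "\<forall>s\<in>insert w S. (s, 1) \<in> set (h' @ [\<sigma> h'])"
      using S w by (auto simp: h'_def)
    ultimately show ?case by blast
  }
qed

text \<open>The set in \<open>attached\<close> collects the vertices with all neighbors in
  \<open>S\<close>. It is too large to be exhausted when Bob completes some \<open>S\<close>, so he
  can color one of its members 1, and color 2 never dominates that vertex.\<close>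

lemma bob_wins_attached_subsets:
  assumes fin: "finite (pverts G)" and W: "W \<subseteq> pverts G" "2 * k \<le> card W"
    and attached: "\<And>S. S \<subseteq> W \<Longrightarrow> card S = k \<Longrightarrow>
      2 * k + 1 < card {v \<in> pverts G. \<forall>u. (u, v) \<in> parcs G \<longrightarrow> u \<in> S}"
    and "2 \<le> m"
  shows "\<not> alice_has_winning_strategy G X m"
proof
  assume "alice_has_winning_strategy G X m"
  then obtain \<sigma> where \<sigma>: "alice_strategy G X m \<sigma>"
    and win: "\<And>h. complete_play G m h \<Longrightarrow> alice_follows X \<sigma> h \<Longrightarrow> alice_wins G m h"
    by (auto simp: alice_has_winning_strategy_def)
  have fW: "finite W" using W fin finite_subset by blast
  \<comment> \<open>Any \<open>k\<close>-subset will do: its attached vertices alone show that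
    \<open>G\<close> is large enough for \<open>bob_takes_core_vertices\<close>.\<close>
  obtain S0 where "S0 \<subseteq> W" "card S0 = k"
    using W(2) obtain_subset_with_card_n[of k W] by auto
  then have "2 * k + 1 < card (pverts G)"
    using attached[of S0] card_mono[OF fin, of "{v \<in> pverts G. \<forall>u. (u, v) \<in> parcs G \<longrightarrow> u \<in> S0}"]
    by auto
  with fW W \<sigma> \<open>2 \<le> m\<close> obtain h S where h: "play G m h" "alice_follows X \<sigma> h" "to_move X h = Bob"
    "length h \<le> 2 * k + 1" and S: "S \<subseteq> W" "card S = k" "\<forall>s\<in>S. (s, 1) \<in> set h"
    using bob_takes_core_vertices[of W G k m X \<sigma> k] by auto
  let ?A = "{v \<in> pverts G. \<forall>u. (u, v) \<in> parcs G \<longrightarrow> u \<in> S}"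
  have "\<not> ?A \<subseteq> fst ` set h"
    using attached[OF S(1,2)] card_mono[of "fst ` set h" ?A] card_played[OF h(1)] h(4)
    by fastforce
  then obtain v where v: "v \<in> pverts G" "\<And>u. (u, v) \<in> parcs G \<Longrightarrow> u \<in> S" "v \<notin> fst ` set h"
    by blast
  have "play G m (h @ [(v, 1)])" "alice_follows X \<sigma> (h @ [(v, 1)])"
    using h v \<open>2 \<le> m\<close> by (auto simp: play_snoc alice_follows_snoc legal_move_def)
  then obtain t where t: "complete_play G m ((h @ [(v, 1)]) @ t)"
    "alice_follows X \<sigma> ((h @ [(v, 1)]) @ t)"
    using complete_play_extension[OF fin _ \<sigma>] \<open>2 \<le> m\<close> by fastforce
  let ?h = "(h @ [(v, 1)]) @ t"
  \<comment> \<open>No later move recolors a vertex, so color 1 on \<open>v\<close> and on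
    \<open>S\<close> persists through \<open>t\<close>.\<close>
  have one: "u \<notin> color_class ?h 2" if "u = v \<or> u \<in> S" for u
  proof
    assume "u \<in> color_class ?h 2"
    moreover have "(u, 1) \<in> set ?h" using that S(3) by auto
    ultimately show False
      using play_color_unique[of G m ?h u 1 2] t(1) by (simp add: color_class_def complete_play_def)
  qed
  have "dominating_set G (color_class ?h 2)"
    using win[OF t] \<open>2 \<le> m\<close> by (simp add: alice_wins_def)
  then show False
    using v(1,2) one unfolding dominating_set_def by blast
qed

lemma domatic_game_number_eq_1:
  assumes "\<And>m. 2 \<le> m \<Longrightarrow> \<not> alice_has_winning_strategy G X m"
  shows "domatic_game_number G X = 1"
  unfolding domatic_game_number_def
proof (rule Greatest_equality)
  show "1 \<le> (1::nat) \<and> alice_has_winning_strategy G X 1"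
    using alice_wins_palette_1 by simp
  show "y \<le> 1" if "1 \<le> y \<and> alice_has_winning_strategy G X y" for y
    using that assms[of y] by (cases "2 \<le> y") auto
qed

section \<open>The witness graph\<close>

text \<open>
  The core vertices are the numbers below \<^term>\<open>2 * k\<close>. The \<^term>\<open>j\<close>-th vertex attached to \<^term>\<open>S\<close>
  is encoded so that it is at least \<^term>\<open>2 * k\<close> and \<^term>\<open>S\<close> can be decoded from it.
\<close>
definition attach :: "nat \<Rightarrow> nat set \<times> nat \<Rightarrow> nat" where
  "attach k = (\<lambda>(S, j). prod_encode (set_encode S, 2 * k + j))"

definition attached_to :: "nat \<Rightarrow> nat set" where
  "attached_to v = set_decode (fst (prod_decode v))"

definition attached_vertices :: "nat \<Rightarrow> nat set" where
  "attached_vertices k = attach k ` ({S. S \<subseteq> {..<2 * k} \<and> card S = k} \<times> {..<2 * k + 2})"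

text \<open>The bipartite incidence graph between the core and its \<open>k\<close>-subsets, each
  subset repeated \<open>2 * k + 2\<close> times.\<close>

definition subset_graph :: "nat \<Rightarrow> nat pair_pre_digraph" where
  "subset_graph k = \<lparr> pverts = {..<2 * k} \<union> attached_vertices k,
     parcs = Sigma (attached_vertices k) attached_to \<union> (Sigma (attached_vertices k) attached_to)\<inverse> \<rparr>"

lemma attached_to_attach: "finite S \<Longrightarrow> attached_to (attach k (S, j)) = S"
  by (simp add: attached_to_def attach_def)

text \<open>\<open>prod_encode\<close> is at least its second component, so the offset
  \<open>2 * k\<close> keeps attached vertices out of the core.\<close>

lemma attach_ge: "2 * k \<le> attach k (S, j)"
  using le_prod_encode_2[of "2 * k + j" "set_encode S"] by (simp add: attach_def)

lemma inj_attach: "inj (\<lambda>j. attach k (S, j))"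
  by (auto simp: inj_on_def attach_def prod_encode_eq)

lemma attached_vertices_props:
  assumes "v \<in> attached_vertices k"
  shows "2 * k \<le> v" "attached_to v \<subseteq> {..<2 * k}" "card (attached_to v) = k"
  using assms attach_ge finite_subset[of _ "{..<2 * k}"]
  by (auto simp: attached_vertices_def attached_to_attach)

lemma finite_attached_vertices [simp]: "finite (attached_vertices k)"
  by (simp add: attached_vertices_def)

lemma pair_graph_subset_graph: "pair_graph (subset_graph k)"
proof
  have fin: "finite (Sigma (attached_vertices k) attached_to)"
    by (auto intro!: finite_SigmaI finite_subset[OF attached_vertices_props(2)])
  then show "finite (parcs (subset_graph k))"
    by (simp add: subset_graph_def)
  show "finite (pverts (subset_graph k))"
    by (simp add: subset_graph_def)
  show "symmetric (with_proj (subset_graph k))"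
    by (auto simp: subset_graph_def symmetric_def arcs_ends_def arc_to_ends_def sym_def)
\<comment> \<open>Every arc joins a number below \<open>2 * k\<close> to one that is at least
  \<open>2 * k\<close>, which excludes loops.\<close>
qed (use attached_vertices_props in \<open>fastforce simp: subset_graph_def\<close>)+

text \<open>The number of copies beats the \<open>2 * k + 1\<close> vertices colored before Bob's
  last move, and also bounds the core degrees from below.\<close>

lemma card_attached_ge:
  assumes "S \<subseteq> {..<2 * k}" "card S = k"
  shows "2 * k + 2 \<le> card {v \<in> attached_vertices k. attached_to v = S}"
proof -
  have "finite S" using assms finite_subset by blast
  then have "(\<lambda>j. attach k (S, j)) ` {..<2 * k + 2} \<subseteq> {v \<in> attached_vertices k. attached_to v = S}"
    using assms by (auto simp: attached_vertices_def attached_to_attach)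
  then have "card ((\<lambda>j. attach k (S, j)) ` {..<2 * k + 2})
      \<le> card {v \<in> attached_vertices k. attached_to v = S}"
    by (intro card_mono) auto
  then show ?thesis
    using card_image[OF inj_on_subset[OF inj_attach subset_UNIV], of k S "{..<2 * k + 2}"] by simp
qed

lemma out_degree_with_proj: "out_degree (with_proj G) v = card {u. (v, u) \<in> parcs G}"
proof -
  have "out_arcs (with_proj G) v = Pair v ` {u. (v, u) \<in> parcs G}"
    by (auto simp: out_arcs_def)
  then show ?thesis
    by (simp add: out_degree_def card_image inj_on_def)
qed

lemma min_degree_subset_graph:
  assumes "1 \<le> k"
  shows "min_degree (subset_graph k) = k"
proof -
  let ?G = "subset_graph k"
  have attached: "out_degree (with_proj ?G) v = k" if "v \<in> attached_vertices k" for v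
  proof -
    have "{u. (v, u) \<in> parcs ?G} = attached_to v"
      using that attached_vertices_props[OF that] attached_vertices_props(2)
      by (fastforce simp: subset_graph_def)
    then show ?thesis
      using attached_vertices_props[OF that] by (simp add: out_degree_with_proj)
  qed
  have core: "k \<le> out_degree (with_proj ?G) w" if w: "w < 2 * k" for w
  proof -
    \<comment> \<open>Completing \<open>w\<close> to a \<open>k\<close>-subset of the core: all
      vertices attached to that subset are neighbors of \<open>w\<close>.\<close>
    have "k - 1 \<le> card ({..<2 * k} - {w})" using w by simp
    then obtain T where T: "T \<subseteq> {..<2 * k} - {w}" "card T = k - 1"
      by (rule obtain_subset_with_card_n)
    have "finite T" "w \<notin> T" using T finite_subset by blast+
    then have S: "insert w T \<subseteq> {..<2 * k}" "card (insert w T) = k"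
      using T w assms by auto
    have "{v \<in> attached_vertices k. attached_to v = insert w T} \<subseteq> {u. (w, u) \<in> parcs ?G}"
      by (auto simp: subset_graph_def)
    moreover have "{u. (w, u) \<in> parcs ?G} \<subseteq> attached_vertices k"
      using w attached_vertices_props(1)[of w k] by (auto simp: subset_graph_def)
    then have "finite {u. (w, u) \<in> parcs ?G}"
      by (rule finite_subset) simp
    ultimately have "card {v \<in> attached_vertices k. attached_to v = insert w T}
        \<le> out_degree (with_proj ?G) w"
      by (simp add: out_degree_with_proj card_mono)
    then show ?thesis using card_attached_ge[OF S] by simp
  qed
  \<comment> \<open>An attached vertex must exist for the value \<open>k\<close> to be
    attained.\<close>
  have "{v \<in> attached_vertices k. attached_to v = {..<k}} \<noteq> {}"
    using card_attached_ge[of "{..<k}" k] by (intro notI) auto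
  then obtain v where "v \<in> attached_vertices k" by blast
  then show ?thesis
    unfolding min_degree_def using attached core
    by (intro Min_eqI) (force simp: subset_graph_def)+
qed

theorem corollary2p6:
  fixes k :: nat
  assumes "k \<ge> 1"
  shows "\<exists>G :: nat pair_pre_digraph.
           pair_graph G \<and> pverts G \<noteq> {} \<and> min_degree G = k \<and>
           (\<forall>X. domatic_game_number G X = 1)"
proof (intro exI conjI allI)
  let ?G = "subset_graph k"
  show "pair_graph ?G" by (rule pair_graph_subset_graph)
  show "pverts ?G \<noteq> {}" using assms by (auto simp: subset_graph_def lessThan_empty_iff)
  show "min_degree ?G = k" using assms by (rule min_degree_subset_graph)
  have fin: "finite (pverts ?G)" by (simp add: subset_graph_def)
  have many: "2 * k + 1 < card {v \<in> pverts ?G. \<forall>u. (u, v) \<in> parcs ?G \<longrightarrow> u \<in> S}"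
    if "S \<subseteq> {..<2 * k}" "card S = k" for S
  proof -
    \<comment> \<open>An attached vertex is at least \<open>2 * k\<close>, hence lies in no set
      \<open>attached_to u\<close>; its arcs come only from the core vertices in
      \<open>S\<close>.\<close>
    have "{v \<in> attached_vertices k. attached_to v = S}
        \<subseteq> {v \<in> pverts ?G. \<forall>u. (u, v) \<in> parcs ?G \<longrightarrow> u \<in> S}"
      using attached_vertices_props by (fastforce simp: subset_graph_def)
    then have "card {v \<in> attached_vertices k. attached_to v = S}
        \<le> card {v \<in> pverts ?G. \<forall>u. (u, v) \<in> parcs ?G \<longrightarrow> u \<in> S}"
      using fin by (intro card_mono) auto
    then show ?thesis using card_attached_ge[OF that] by linarith
  qed
  show "domatic_game_number ?G X = 1" for X
    by (intro domatic_game_number_eq_1 bob_wins_attached_subsets[where W = "{..<2 * k}" and k = k]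
        fin many) (auto simp: subset_graph_def)
qed

end
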